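(* Let $L$ be a logic. If $U$ is a nonprincipal ultrafilter on some countable set $I$, then the ultrapower $(\mathbb{C}\mathbf{A}_{L_\omega})^U$ is of size $\mathfrak{c}$, the cardinal of the continuum, while $\mathbb{C}(\mathbf{A}_{L_\omega}^{\;U})$ is of size $2^{\mathfrak{c}}$.
   Context: Modal formulas are built from propositional variables $p_\xi$ (one for each ordinal $\xi$) using $\bot$, $\to$ and the unary modality $\Box$ (other Boolean connectives and $\Diamond$ are defined as usual). A logic is any class $L$ of formulas containing all instances of tautologies and of the scheme $\Box(A\to B)\to(\Box A\to\Box B)$ and closed under modus ponens, uniform substitution of formulas for variables, and necessitation (from $A$ infer $\Box A$). An $\omega$-formula is a formula whose variables belong to $\{p_\xi:\xi<\omega\}$, and $L_\omega$ is the set of all $\omega$-formulas belonging to $L$. A frame $(X,R)$ is a set $X$ with a binary relation $R$ on $X$; its size is the cardinality of $X$. A modal algebra $\mathbf{A}=(\mathbf{B},l)$ is a Boolean algebra $\mathbf{B}$ with a function $l:\mathbf{B}\to\mathbf{B}$ preserving binary meets and the greatest element. Its canonical frame is $\mathbb{C}\mathbf{A}=(X_{\mathbf{B}},R_l)$, where $X_{\mathbf{B}}$ is the set of ultrafilters of $\mathbf{B}$ and $F R_l G$ iff $\{a: la\in F\}\subseteq G$. $\mathbf{A}_{L_\omega}$ is the Lindenbaum–Tarski algebra of $L_\omega$: its elements are the equivalence classes $[A]$ of $\omega$-formulas, where $[A]=[B]$ iff $A\leftrightarrow B\in L$, with Boolean operations induced by the connectives and $l[A]=[\Box A]$. For an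 ultrafilter $U$ on a set $I$, $(\cdot)^U$ denotes the ultrapower modulo $U$ (of a frame or of a modal algebra, respectively): functions on $I$ modulo agreement on a set in $U$, with the usual induced relation (related iff related on a set of indices in $U$) or operations.
   Formalization: The logic L is assumed consistent (⊥ not in L); for the inconsistent logic the Lindenbaum–Tarski algebra has one element and no ultrafilters, so both frames are empty and the claim fails. *)

theory Defs
  imports
    "HOL-Library.FuncSet"
    "HOL-Library.Equipollence"
    "HOL-Library.Countable_Set"
    "HOL-Library.Infinite_Typeclass"
begin

section \<open>Modal formulas and logics\<close>

text \<open>
  The variables \<open>p\<^sub>\<xi>\<close> are indexed by the elements \<open>\<xi>\<close> of a type \<open>'v\<close>.  There is no type of all
  ordinals, so \<open>'v\<close> will range over all infinite well-ordered types, i.e. over the initial segments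
  of the ordinals of length at least \<open>\<omega>\<close>.
\<close>

datatype (vars: 'v) fm =
    Var 'v
  | Fls
  | Imp "'v fm" "'v fm"
  | Box "'v fm"

definition Neg :: "'v fm \<Rightarrow> 'v fm" where
  "Neg A = Imp A Fls"

definition Tru :: "'v fm" where
  "Tru = Neg Fls"

definition Or :: "'v fm \<Rightarrow> 'v fm \<Rightarrow> 'v fm" where
  "Or A B = Imp (Neg A) B"

definition And :: "'v fm \<Rightarrow> 'v fm \<Rightarrow> 'v fm" where
  "And A B = Neg (Imp A (Neg B))"

definition Iff :: "'v fm \<Rightarrow> 'v fm \<Rightarrow> 'v fm" where
  "Iff A B = And (Imp A B) (Imp B A)"

primrec subst :: "('v \<Rightarrow> 'v fm) \<Rightarrow> 'v fm \<Rightarrow> 'v fm" where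
  "subst s (Var x) = s x"
| "subst s Fls = Fls"
| "subst s (Imp A B) = Imp (subst s A) (subst s B)"
| "subst s (Box A) = Box (subst s A)"

primrec box_free :: "'v fm \<Rightarrow> bool" where
  "box_free (Var x) = True"
| "box_free Fls = True"
| "box_free (Imp A B) = (box_free A \<and> box_free B)"
| "box_free (Box A) = False"

text \<open>The clause for \<open>Box\<close> is a dummy: \<open>truth\<close> is only used on box-free formulas.\<close>

primrec truth :: "('v \<Rightarrow> bool) \<Rightarrow> 'v fm \<Rightarrow> bool" where
  "truth v (Var x) = v x"
| "truth v Fls = False"
| "truth v (Imp A B) = (truth v A \<longrightarrow> truth v B)"
| "truth v (Box A) = False"

definition tautology :: "'v fm \<Rightarrow> bool" where
  "tautology A \<longleftrightarrow> box_free A \<and> (\<forall>v. truth v A)"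

definition logic :: "'v fm set \<Rightarrow> bool" where
  "logic L \<longleftrightarrow>
     (\<forall>A s. tautology A \<longrightarrow> subst s A \<in> L) \<and>
     (\<forall>A B. Imp (Box (Imp A B)) (Imp (Box A) (Box B)) \<in> L) \<and>
     (\<forall>A B. Imp A B \<in> L \<longrightarrow> A \<in> L \<longrightarrow> B \<in> L) \<and>
     (\<forall>A s. A \<in> L \<longrightarrow> subst s A \<in> L) \<and>
     (\<forall>A. A \<in> L \<longrightarrow> Box A \<in> L)"

text \<open>In a well-order, \<open>\<xi> < \<omega>\<close> holds iff \<open>\<xi>\<close> has only finitely many predecessors.\<close>

definition omega_fms :: "'v::wellorder fm set" where
  "omega_fms = {A. \<forall>\<xi>\<in>vars A. finite {..<\<xi>}}"

definition omega_part :: "'v::wellorder fm set \<Rightarrow> 'v fm set" where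
  "omega_part L = L \<inter> omega_fms"


section \<open>Frames and modal algebras\<close>

record 'a frame =
  worlds :: "'a set"
  rel :: "('a \<times> 'a) set"

record 'a malg =
  carrier :: "'a set"
  meet :: "'a \<Rightarrow> 'a \<Rightarrow> 'a"
  join :: "'a \<Rightarrow> 'a \<Rightarrow> 'a"
  compl :: "'a \<Rightarrow> 'a"
  zero :: 'a
  one :: 'a
  box :: "'a \<Rightarrow> 'a"

text \<open>Boolean algebras are axiomatised as in \<^locale>\<open>abstract_boolean_algebra\<close>, relative to a carrier.\<close>

definition boolean_algebra_on :: "('a, 'b) malg_scheme \<Rightarrow> bool" where
  "boolean_algebra_on M \<longleftrightarrow>
     zero M \<in> carrier M \<and> one M \<in> carrier M \<and>
     (\<forall>a\<in>carrier M. compl M a \<in> carrier M \<and>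
        meet M a (one M) = a \<and> join M a (zero M) = a \<and>
        meet M a (compl M a) = zero M \<and> join M a (compl M a) = one M) \<and>
     (\<forall>a\<in>carrier M. \<forall>b\<in>carrier M.
        meet M a b \<in> carrier M \<and> join M a b \<in> carrier M \<and>
        meet M a b = meet M b a \<and> join M a b = join M b a) \<and>
     (\<forall>a\<in>carrier M. \<forall>b\<in>carrier M. \<forall>c\<in>carrier M.
        meet M (meet M a b) c = meet M a (meet M b c) \<and>
        join M (join M a b) c = join M a (join M b c) \<and>
        meet M a (join M b c) = join M (meet M a b) (meet M a c) \<and>
        join M a (meet M b c) = meet M (join M a b) (join M a c))"

definition modal_algebra :: "('a, 'b) malg_scheme \<Rightarrow> bool" where
  "modal_algebra M \<longleftrightarrow>
     boolean_algebra_on M \<and>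
     (\<forall>a\<in>carrier M. box M a \<in> carrier M) \<and>
     (\<forall>a\<in>carrier M. \<forall>b\<in>carrier M. box M (meet M a b) = meet M (box M a) (box M b)) \<and>
     box M (one M) = one M"

text \<open>
  The operations below are defined for arbitrary records; they have their intended meaning when the
  record satisfies \<open>modal_algebra\<close>.
\<close>

definition ultrafilters :: "('a, 'b) malg_scheme \<Rightarrow> 'a set set" where
  "ultrafilters M =
     {F. F \<subseteq> carrier M \<and> one M \<in> F \<and> zero M \<notin> F \<and>
         (\<forall>a\<in>F. \<forall>b\<in>F. meet M a b \<in> F) \<and>
         (\<forall>a\<in>F. \<forall>b\<in>carrier M. meet M a b = a \<longrightarrow> b \<in> F) \<and>
         (\<forall>a\<in>carrier M. a \<in> F \<or> compl M a \<in> F)}"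

definition canonical_frame :: "('a, 'b) malg_scheme \<Rightarrow> 'a set frame" where
  "canonical_frame M =
     \<lparr>worlds = ultrafilters M,
      rel = {(F, G). F \<in> ultrafilters M \<and> G \<in> ultrafilters M \<and>
                     {a \<in> carrier M. box M a \<in> F} \<subseteq> G}\<rparr>"


section \<open>Lindenbaum--Tarski algebras\<close>

definition lt_class :: "'v::wellorder fm set \<Rightarrow> 'v fm \<Rightarrow> 'v fm set" where
  "lt_class T A = {B \<in> omega_fms. Iff A B \<in> T}"

text \<open>An operation on classes is the union of its values over all choices of representatives.\<close>

definition lindenbaum :: "'v::wellorder fm set \<Rightarrow> 'v fm set malg" where
  "lindenbaum T =
     \<lparr>carrier = lt_class T ` omega_fms,
      meet = (\<lambda>a b. \<Union>A\<in>a. \<Union>B\<in>b. lt_class T (And A B)),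
      join = (\<lambda>a b. \<Union>A\<in>a. \<Union>B\<in>b. lt_class T (Or A B)),
      compl = (\<lambda>a. \<Union>A\<in>a. lt_class T (Neg A)),
      zero = lt_class T Fls,
      one = lt_class T Tru,
      box = (\<lambda>a. \<Union>A\<in>a. lt_class T (Box A))\<rparr>"


section \<open>Ultrapowers\<close>

definition ultrafilter_on :: "'i set \<Rightarrow> 'i set set \<Rightarrow> bool" where
  "ultrafilter_on I U \<longleftrightarrow>
     U \<subseteq> Pow I \<and> I \<in> U \<and> {} \<notin> U \<and>
     (\<forall>S\<in>U. \<forall>T\<in>U. S \<inter> T \<in> U) \<and>
     (\<forall>S\<in>U. \<forall>T. S \<subseteq> T \<longrightarrow> T \<subseteq> I \<longrightarrow> T \<in> U) \<and>
     (\<forall>S. S \<subseteq> I \<longrightarrow> S \<in> U \<or> I - S \<in> U)"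

definition principal_on :: "'i set \<Rightarrow> 'i set set \<Rightarrow> bool" where
  "principal_on I U \<longleftrightarrow> (\<exists>i\<in>I. U = {S. S \<subseteq> I \<and> i \<in> S})"

definition up_eq :: "'i set \<Rightarrow> 'i set set \<Rightarrow> 'a set \<Rightarrow> (('i \<Rightarrow> 'a) \<times> ('i \<Rightarrow> 'a)) set" where
  "up_eq I U X = {(f, g). f \<in> (I \<rightarrow>\<^sub>E X) \<and> g \<in> (I \<rightarrow>\<^sub>E X) \<and> {i \<in> I. f i = g i} \<in> U}"

definition up_carrier :: "'i set \<Rightarrow> 'i set set \<Rightarrow> 'a set \<Rightarrow> ('i \<Rightarrow> 'a) set set" where
  "up_carrier I U X = (I \<rightarrow>\<^sub>E X) // up_eq I U X"

definition up_class :: "'i set \<Rightarrow> 'i set set \<Rightarrow> 'a set \<Rightarrow> ('i \<Rightarrow> 'a) \<Rightarrow> ('i \<Rightarrow> 'a) set" where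
  "up_class I U X f = up_eq I U X `` {restrict f I}"

definition frame_ultrapower ::
    "'i set \<Rightarrow> 'i set set \<Rightarrow> ('a, 'b) frame_scheme \<Rightarrow> ('i \<Rightarrow> 'a) set frame" where
  "frame_ultrapower I U \<F> =
     \<lparr>worlds = up_carrier I U (worlds \<F>),
      rel = {(c, d). c \<in> up_carrier I U (worlds \<F>) \<and> d \<in> up_carrier I U (worlds \<F>) \<and>
                     (\<exists>f\<in>c. \<exists>g\<in>d. {i \<in> I. (f i, g i) \<in> rel \<F>} \<in> U)}\<rparr>"

definition malg_ultrapower ::
    "'i set \<Rightarrow> 'i set set \<Rightarrow> ('a, 'b) malg_scheme \<Rightarrow> ('i \<Rightarrow> 'a) set malg" where
  "malg_ultrapower I U M =
     (let cl = up_class I U (carrier M) in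
      \<lparr>carrier = up_carrier I U (carrier M),
       meet = (\<lambda>c d. \<Union>f\<in>c. \<Union>g\<in>d. cl (\<lambda>i. meet M (f i) (g i))),
       join = (\<lambda>c d. \<Union>f\<in>c. \<Union>g\<in>d. cl (\<lambda>i. join M (f i) (g i))),
       compl = (\<lambda>c. \<Union>f\<in>c. cl (\<lambda>i. compl M (f i))),
       zero = cl (\<lambda>i. zero M),
       one = cl (\<lambda>i. one M),
       box = (\<lambda>c. \<Union>f\<in>c. cl (\<lambda>i. box M (f i)))\<rparr>)"

end

theory Submission
  imports Defs "HOL-Analysis.Abstract_Topology_2" "HOL-Library.Nat_Bijection"
begin

text \<open>
  Consistency of \<open>L\<close> makes the classes of the variables independent in the countable
  Lindenbaum--Tarski algebra: substituting truth constants for the variables sends no theorem to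
  \<open>\<bottom>\<close>. Hence there are continuum many ultrafilters, and the ultrapower of the frame over a countable
  index set keeps this size. In the ultrapower of the algebra, take for each set \<open>S\<close> of naturals the
  sequence whose \<open>i\<close>-th entry is the variable coded by the part of \<open>S\<close> below \<open>i\<close>. Finitely many of these
  sequences are pairwise distinct at all but finitely many places, so modulo a nonprincipal
  ultrafilter they form an independent family of size continuum, and each of its subsets
  is cut out by an ultrafilter.
\<close>

section \<open>Filters in Boolean algebras\<close>

text \<open>The clauses of \<open>ultrafilters\<close> except the last. The filters constructed
  below need not be maximal; maximality is supplied separately by Zorn's lemma.\<close>

definition proper_filters :: "('a, 'b) malg_scheme \<Rightarrow> 'a set set" where
  "proper_filters M =
     {F. F \<subseteq> carrier M \<and> one M \<in> F \<and> zero M \<notin> F \<and>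
         (\<forall>a\<in>F. \<forall>b\<in>F. meet M a b \<in> F) \<and>
         (\<forall>a\<in>F. \<forall>b\<in>carrier M. meet M a b = a \<longrightarrow> b \<in> F)}"

lemma ultrafilters_iff:
  "F \<in> ultrafilters M \<longleftrightarrow>
     F \<in> proper_filters M \<and> (\<forall>a\<in>carrier M. a \<in> F \<or> compl M a \<in> F)"
  by (auto simp: ultrafilters_def proper_filters_def)

lemma proper_filtersD:
  assumes "F \<in> proper_filters M"
  shows "F \<subseteq> carrier M" "one M \<in> F" "zero M \<notin> F"
    and "\<And>a b. a \<in> F \<Longrightarrow> b \<in> F \<Longrightarrow> meet M a b \<in> F"
    and "\<And>a b. a \<in> F \<Longrightarrow> b \<in> carrier M \<Longrightarrow> meet M a b = a \<Longrightarrow> b \<in> F"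
  using assms by (auto simp: proper_filters_def)

text \<open>Only closure under meets needs comparability: of two filters in the chain, the larger
  contains both elements.\<close>

lemma proper_filter_Union_chain:
  assumes "C \<noteq> {}" "C \<subseteq> proper_filters M" "\<And>F G. F \<in> C \<Longrightarrow> G \<in> C \<Longrightarrow> F \<subseteq> G \<or> G \<subseteq> F"
  shows "\<Union>C \<in> proper_filters M"
proof -
  have D: "F \<in> proper_filters M" if "F \<in> C" for F
    using assms(2) that by blast
  have meet: "meet M a b \<in> \<Union>C" if "a \<in> F" "F \<in> C" "b \<in> G" "G \<in> C" for a b F G
    using assms(3)[OF that(2,4)] that proper_filtersD(4)[OF D] by blast
  show ?thesis
    unfolding proper_filters_def
  proof (intro CollectI conjI ballI impI)
    show "\<Union>C \<subseteq> carrier M" using proper_filtersD(1)[OF D] by blast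
    show "one M \<in> \<Union>C" using assms(1) proper_filtersD(2)[OF D] by blast
    show "zero M \<notin> \<Union>C" using proper_filtersD(3)[OF D] by blast
    show "meet M a b \<in> \<Union>C" if "a \<in> \<Union>C" "b \<in> \<Union>C" for a b
      using that meet by (elim UnionE)
    show "b \<in> \<Union>C" if "a \<in> \<Union>C" "b \<in> carrier M" "meet M a b = a" for a b
      using that proper_filtersD(5)[OF D] by (elim UnionE) (rule UnionI)
  qed
qed

text \<open>
  The filter consists of the elements that belong to every proper filter containing a suitable
  finite part of \<open>G\<close>, which avoids finite meets altogether.
\<close>

lemma proper_filter_of_finite:
  assumes ex: "\<And>E. finite E \<Longrightarrow> E \<subseteq> G \<Longrightarrow> \<exists>F\<in>proper_filters M. E \<subseteq> F"
  shows "\<exists>F\<in>proper_filters M. G \<subseteq> F"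
proof
  define P where "P E b \<longleftrightarrow> finite E \<and> E \<subseteq> G \<and> (\<forall>H\<in>proper_filters M. E \<subseteq> H \<longrightarrow> b \<in> H)" for E b
  let ?F = "{b. \<exists>E. P E b}"
  \<comment> \<open>This excludes the vacuous case of \<open>P\<close>, in which no proper filter
    contains \<open>E\<close> and even \<open>zero M\<close> would qualify.\<close>
  have witness: "\<exists>H\<in>proper_filters M. b \<in> H" if "P E b" for E b
    using ex[of E] that unfolding P_def by blast
  show "?F \<in> proper_filters M"
    unfolding proper_filters_def
  proof (intro CollectI conjI ballI impI)
    show "?F \<subseteq> carrier M"
      using witness proper_filtersD(1) by blast
    show "\<exists>E. P E (one M)"
      using proper_filtersD(2) by (intro exI[of _ "{}"]) (auto simp: P_def)
    show "zero M \<notin> ?F"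
      using witness proper_filtersD(3) by blast
  next
    fix a b assume "a \<in> ?F" "b \<in> ?F"
    then obtain E1 E2 where "P E1 a" "P E2 b" by blast
    then have "P (E1 \<union> E2) (meet M a b)"
      unfolding P_def by (auto intro!: proper_filtersD(4))
    then show "\<exists>E. P E (meet M a b)" by blast
  next
    fix a b assume "a \<in> ?F" and b: "b \<in> carrier M" "meet M a b = a"
    then obtain E where "P E a" by blast
    then have "P E b"
      unfolding P_def using b by (auto intro: proper_filtersD(5)[of _ _ a])
    then show "\<exists>E. P E b" by blast
  qed
  show "G \<subseteq> ?F"
  proof
    fix g assume "g \<in> G"
    then have "P {g} g" by (auto simp: P_def)
    then show "g \<in> ?F" by blast
  qed
qed

section \<open>Boolean identities and the extension of filters to ultrafilters\<close>

context
  fixes M :: "('a, 'b) malg_scheme"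
  assumes BA: "boolean_algebra_on M"
begin

lemma ba_closed [simp]:
  "zero M \<in> carrier M" "one M \<in> carrier M"
  "a \<in> carrier M \<Longrightarrow> compl M a \<in> carrier M"
  "a \<in> carrier M \<Longrightarrow> b \<in> carrier M \<Longrightarrow> meet M a b \<in> carrier M"
  "a \<in> carrier M \<Longrightarrow> b \<in> carrier M \<Longrightarrow> join M a b \<in> carrier M"
  using BA by (auto simp: boolean_algebra_on_def)

lemma ba_one_zero [simp]:
  "a \<in> carrier M \<Longrightarrow> meet M a (one M) = a"
  "a \<in> carrier M \<Longrightarrow> join M a (zero M) = a"
  "a \<in> carrier M \<Longrightarrow> meet M a (compl M a) = zero M"
  "a \<in> carrier M \<Longrightarrow> join M a (compl M a) = one M"
  using BA by (auto simp: boolean_algebra_on_def)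

lemma ba_meet_commute: "a \<in> carrier M \<Longrightarrow> b \<in> carrier M \<Longrightarrow> meet M a b = meet M b a"
  and ba_join_commute: "a \<in> carrier M \<Longrightarrow> b \<in> carrier M \<Longrightarrow> join M a b = join M b a"
  using BA by (auto simp: boolean_algebra_on_def)

lemma ba_meet_assoc:
  "a \<in> carrier M \<Longrightarrow> b \<in> carrier M \<Longrightarrow> c \<in> carrier M \<Longrightarrow>
     meet M (meet M a b) c = meet M a (meet M b c)"
  and ba_distrib:
  "a \<in> carrier M \<Longrightarrow> b \<in> carrier M \<Longrightarrow> c \<in> carrier M \<Longrightarrow>
     meet M a (join M b c) = join M (meet M a b) (meet M a c)"
  using BA unfolding boolean_algebra_on_def by metis+

lemma ba_meet_idem: "a \<in> carrier M \<Longrightarrow> meet M a a = a"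
  by (metis ba_closed(3,4) ba_distrib ba_one_zero)

lemma ba_meet_zero: "a \<in> carrier M \<Longrightarrow> meet M a (zero M) = zero M"
  by (metis ba_closed(3) ba_meet_assoc ba_meet_idem ba_one_zero(3))

text \<open>By distributivity \<open>c\<close> is the join of its meets with \<open>a\<close> and
  \<open>compl M a\<close>, and the first of these vanishes.\<close>

lemma ba_meet_compl_eq:
  assumes "a \<in> carrier M" "c \<in> carrier M" "meet M c a = zero M"
  shows "meet M c (compl M a) = c"
proof -
  have "c = meet M c (join M a (compl M a))" using assms by simp
  also have "\<dots> = join M (zero M) (meet M c (compl M a))"
    using assms by (simp only: ba_distrib ba_closed)
  also have "\<dots> = meet M c (compl M a)"
    using assms by (simp add: ba_join_commute[of "zero M"])
  finally show ?thesis by simp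
qed

lemma compl_notin_proper_filter:
  assumes "F \<in> proper_filters M" "a \<in> F"
  shows "compl M a \<notin> F"
  using proper_filtersD[OF assms(1)] assms(2) by (metis ba_one_zero(3) subsetD)

text \<open>If \<open>meet M c a\<close> were zero for some \<open>c\<close> in \<open>F\<close>,
  then \<open>c\<close> would lie below \<open>compl M a\<close>, which would therefore belong to
  \<open>F\<close>.\<close>

lemma proper_filter_insert:
  assumes F: "F \<in> proper_filters M" and a: "a \<in> carrier M" and n: "compl M a \<notin> F"
  shows "\<exists>G\<in>proper_filters M. insert a F \<subseteq> G"
proof
  \<comment> \<open>The filter generated by \<open>F\<close> and \<open>a\<close>; the equation
    \<open>meet M x y = x\<close> expresses that \<open>x\<close> lies below
    \<open>y\<close>.\<close>
  let ?G = "{b \<in> carrier M. \<exists>c\<in>F. meet M (meet M c a) b = meet M c a}"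
  note D = proper_filtersD[OF F]
  have c: "c \<in> carrier M" if "c \<in> F" for c using D(1) that by blast
  show "?G \<in> proper_filters M"
    unfolding proper_filters_def
  proof (intro CollectI conjI ballI impI)
    show "?G \<subseteq> carrier M" by blast
    show "one M \<in> carrier M" by simp
    show "\<exists>c\<in>F. meet M (meet M c a) (one M) = meet M c a"
      using D(2) a by (intro bexI[of _ "one M"]) auto
    show "zero M \<notin> ?G"
    proof
      assume "zero M \<in> ?G"
      then obtain c where cF: "c \<in> F" "meet M (meet M c a) (zero M) = meet M c a" by blast
      then have "meet M c a = zero M" using c a by (simp add: ba_meet_zero)
      then have "meet M c (compl M a) = c" using ba_meet_compl_eq a c cF(1) by blast
      then show False using D(5) cF(1) a n by auto
    qed
  next
    fix x y assume "x \<in> ?G" "y \<in> ?G"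
    then obtain c d where x: "x \<in> carrier M" "c \<in> F" "meet M (meet M c a) x = meet M c a"
      and y: "y \<in> carrier M" "d \<in> F" "meet M (meet M d a) y = meet M d a" by blast
    then show "meet M x y \<in> carrier M" by simp
    \<comment> \<open>Since \<open>w\<close> lies below both \<open>u\<close> and \<open>v\<close>,
      it lies below \<open>x\<close> and \<open>y\<close>, so \<open>meet M c d\<close> is the
      witness for \<open>meet M x y\<close>.\<close>
    define u v w where "u = meet M c a" and "v = meet M d a" and "w = meet M (meet M c d) a"
    have in_carrier: "u \<in> carrier M" "v \<in> carrier M" "w \<in> carrier M"
      using x y c a by (auto simp: u_def v_def w_def)
    have "w = meet M d u" "w = meet M c v"
      unfolding w_def u_def v_def using x y c a by (metis ba_meet_assoc ba_meet_commute)+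
    then have "meet M w x = w" "meet M w y = w"
      using x y c in_carrier by (metis ba_meet_assoc u_def v_def)+
    then have "meet M w (meet M x y) = w"
      using x(1) y(1) in_carrier by (metis ba_meet_assoc)
    then show "\<exists>e\<in>F. meet M (meet M e a) (meet M x y) = meet M e a"
      using D(4) x(2) y(2) w_def by blast
  next
    fix x y assume "x \<in> ?G" and y: "y \<in> carrier M" "meet M x y = x"
    then obtain c where x: "x \<in> carrier M" "c \<in> F" "meet M (meet M c a) x = meet M c a"
      by blast
    show "y \<in> carrier M" by fact
    have "meet M (meet M c a) y = meet M c a"
      using x y a c ba_meet_assoc[of "meet M c a" x y] by simp
    then show "\<exists>c\<in>F. meet M (meet M c a) y = meet M c a"
      using x(2) by blast
  qed
  have "meet M (meet M c a) c = meet M c a" if "c \<in> F" for c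
    using that a c by (metis ba_meet_assoc ba_meet_commute ba_meet_idem)
  moreover have "meet M (meet M (one M) a) a = meet M (one M) a"
    using a by (simp add: ba_meet_assoc ba_meet_idem)
  ultimately show "insert a F \<subseteq> ?G"
    using D(2) c a by auto
qed

text \<open>A maximal proper filter above \<open>F\<close> is an ultrafilter: if it omits
  \<open>compl M a\<close>, it can be enlarged by \<open>a\<close>, so by maximality it contains
  \<open>a\<close> already.\<close>

lemma ultrafilter_extends:
  assumes F: "F \<in> proper_filters M"
  shows "\<exists>G\<in>ultrafilters M. F \<subseteq> G"
proof -
  let ?A = "{G \<in> proper_filters M. F \<subseteq> G}"
  have "\<exists>G\<in>?A. \<forall>H\<in>?A. G \<subseteq> H \<longrightarrow> H = G"
  proof (rule subset_Zorn_nonempty)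
    show "?A \<noteq> {}" using F by blast
    fix C assume C: "C \<noteq> {}" "subset.chain ?A C"
    then have "\<Union>C \<in> proper_filters M"
      by (intro proper_filter_Union_chain) (auto simp: subset_chain_def)
    moreover have "F \<subseteq> \<Union>C" using C unfolding subset_chain_def by blast
    ultimately show "\<Union>C \<in> ?A" by blast
  qed
  then obtain G where GA: "G \<in> ?A" and max: "\<forall>H\<in>?A. G \<subseteq> H \<longrightarrow> H = G" ..
  then have G: "G \<in> proper_filters M" "F \<subseteq> G" by simp_all
  have "a \<in> G \<or> compl M a \<in> G" if a: "a \<in> carrier M" for a
  proof (rule disjCI)
    assume "compl M a \<notin> G"
    then obtain H where H: "H \<in> proper_filters M" "insert a G \<subseteq> H"
      using proper_filter_insert[OF G(1) a] by blast
    then have "H = G" using max G(2) by auto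
    then show "a \<in> G" using H(2) by blast
  qed
  then have "G \<in> ultrafilters M" using G(1) by (simp add: ultrafilters_iff)
  then show ?thesis using G(2) by blast
qed

lemma ultrafilter_of_finite:
  assumes "\<And>E. finite E \<Longrightarrow> E \<subseteq> G \<Longrightarrow> \<exists>F\<in>proper_filters M. E \<subseteq> F"
  shows "\<exists>F\<in>ultrafilters M. G \<subseteq> F"
  using proper_filter_of_finite[OF assms] ultrafilter_extends by (meson order_trans)

text \<open>By compactness, independence of finite subfamilies gives for every \<open>Y\<close> an
  ultrafilter containing \<open>g s\<close> for exactly those \<open>s\<close> in \<open>S\<close>
  that lie in \<open>Y\<close>. The set \<open>Y\<close> can be read off from it.\<close>

lemma Pow_lepoll_ultrafilters:
  assumes g: "\<And>s. s \<in> S \<Longrightarrow> g s \<in> carrier M"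
    and ind: "\<And>D Y. finite D \<Longrightarrow> D \<subseteq> S \<Longrightarrow> Y \<subseteq> D \<Longrightarrow>
      \<exists>F\<in>proper_filters M. \<forall>s\<in>D. if s \<in> Y then g s \<in> F else compl M (g s) \<in> F"
  shows "Pow S \<lesssim> ultrafilters M"
proof -
  have ex: "\<exists>F\<in>ultrafilters M. \<forall>s\<in>S. g s \<in> F \<longleftrightarrow> s \<in> Y" if "Y \<subseteq> S" for Y
  proof -
    define h where "h s = (if s \<in> Y then g s else compl M (g s))" for s
    have "\<exists>F\<in>ultrafilters M. h ` S \<subseteq> F"
    proof (rule ultrafilter_of_finite)
      fix E assume "finite E" "E \<subseteq> h ` S"
      then obtain D where D: "finite D" "D \<subseteq> S" "E = h ` D"
        by (meson finite_subset_image)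
      show "\<exists>F\<in>proper_filters M. E \<subseteq> F"
      proof -
        \<comment> \<open>The hypothesis \<open>ind\<close> asks for a subset of \<open>D\<close>;
          cutting \<open>Y\<close> down to \<open>Y \<inter> D\<close> changes nothing for
          \<open>s\<close> in \<open>D\<close>.\<close>
        obtain F where "F \<in> proper_filters M"
          "\<forall>s\<in>D. if s \<in> Y \<inter> D then g s \<in> F else compl M (g s) \<in> F"
          using ind[OF D(1,2) Int_lower2, of Y] by blast
        then have "\<forall>s\<in>D. h s \<in> F" by (simp add: h_def split: if_splits)
        then show ?thesis using \<open>F \<in> proper_filters M\<close> D(3) by blast
      qed
    qed
    then obtain F where F: "F \<in> ultrafilters M" "h ` S \<subseteq> F" by blast
    have "g s \<in> F \<longleftrightarrow> s \<in> Y" if "s \<in> S" for s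
    proof -
      have "h s \<in> F" "F \<in> proper_filters M" using F that by (auto simp: ultrafilters_iff)
      then show ?thesis
        using compl_notin_proper_filter[of F "g s"] by (cases "s \<in> Y") (simp_all add: h_def, blast)
    qed
    then show ?thesis using F(1) by blast
  qed
  define W where "W Y = (SOME F. F \<in> ultrafilters M \<and> (\<forall>s\<in>S. g s \<in> F \<longleftrightarrow> s \<in> Y))" for Y
  have W: "W Y \<in> ultrafilters M \<and> (\<forall>s\<in>S. g s \<in> W Y \<longleftrightarrow> s \<in> Y)" if "Y \<subseteq> S" for Y
    unfolding W_def by (rule someI_ex) (use ex[OF that] in blast)
  have "inj_on W (Pow S)"
  proof (rule inj_onI)
    fix Y Z assume YZ: "Y \<in> Pow S" "Z \<in> Pow S" "W Y = W Z"
    then have "s \<in> Y \<longleftrightarrow> s \<in> Z" if "s \<in> S" for s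
      using W[of Y] W[of Z] that by auto
    then show "Y = Z" using YZ by blast
  qed
  then show ?thesis
    unfolding lepoll_def using W by blast
qed

end

section \<open>Ultrapowers\<close>

context
  fixes I :: "'i set" and U :: "'i set set"
  assumes UF: "ultrafilter_on I U"
begin

lemma uf_whole: "I \<in> U" and uf_empty: "{} \<notin> U"
  and uf_Int: "S \<in> U \<Longrightarrow> T \<in> U \<Longrightarrow> S \<inter> T \<in> U"
  and uf_mono: "S \<in> U \<Longrightarrow> S \<subseteq> T \<Longrightarrow> T \<subseteq> I \<Longrightarrow> T \<in> U"
  and uf_compl: "S \<subseteq> I \<Longrightarrow> S \<in> U \<or> I - S \<in> U"
  using UF by (auto simp: ultrafilter_on_def)

text \<open>The working form of the filter laws: pointwise consequences of two facts true almost
  everywhere are true almost everywhere.\<close>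

lemma uf_Collect_mp2:
  assumes "{i \<in> I. P i} \<in> U" "{i \<in> I. Q i} \<in> U" "\<And>i. i \<in> I \<Longrightarrow> P i \<Longrightarrow> Q i \<Longrightarrow> R i"
  shows "{i \<in> I. R i} \<in> U"
  by (rule uf_mono[OF uf_Int[OF assms(1,2)]]) (use assms(3) in auto)

text \<open>A singleton in \<open>U\<close> would make \<open>U\<close> principal. Inductively, the
  complements of \<open>{x}\<close> and of \<open>S\<close> lie in \<open>U\<close>, and so does
  their intersection, which misses \<open>insert x S\<close>.\<close>

lemma finite_notin_nonprincipal_uf:
  assumes np: "\<not> principal_on I U" and "finite S" "S \<subseteq> I"
  shows "S \<notin> U"
  using assms(2,3)
proof (induction S)
  case empty
  then show ?case using uf_empty by simp
next
  case (insert x S)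
  have "{x} \<notin> U"
  proof
    assume x: "{x} \<in> U"
    have "U = {S. S \<subseteq> I \<and> x \<in> S}"
    proof (intro set_eqI iffI)
      fix S assume "S \<in> U"
      moreover from this have "S \<subseteq> I" using UF by (auto simp: ultrafilter_on_def)
      moreover have "x \<in> S" using uf_Int[OF x \<open>S \<in> U\<close>] uf_empty by (cases "x \<in> S") auto
      ultimately show "S \<in> {S. S \<subseteq> I \<and> x \<in> S}" by blast
    qed (use uf_mono[OF x] in auto)
    then show False using np insert.prems by (auto simp: principal_on_def)
  qed
  moreover have "S \<notin> U" using insert by blast
  ultimately have "(I - {x}) \<inter> (I - S) \<in> U"
    using uf_compl[of "{x}"] uf_compl[of S] insert.prems uf_Int by blast
  then have "(I - {x}) \<inter> (I - S) \<inter> insert x S \<in> U" if "insert x S \<in> U"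
    using that uf_Int by blast
  moreover have "(I - {x}) \<inter> (I - S) \<inter> insert x S = {}" by blast
  ultimately show ?case using uf_empty by auto
qed

lemma equiv_up_eq: "equiv (I \<rightarrow>\<^sub>E X) (up_eq I U X)"
proof (rule equivI)
  show "refl_on (I \<rightarrow>\<^sub>E X) (up_eq I U X)"
    using uf_whole by (auto simp: refl_on_def up_eq_def)
  show "sym (up_eq I U X)"
    by (auto simp: sym_def up_eq_def eq_commute)
  show "trans (up_eq I U X)"
    unfolding trans_def up_eq_def by (auto elim: uf_Collect_mp2)
qed (auto simp: up_eq_def)

text \<open>Functions need not be extensional here, so that plain lambda terms can serve as
  representatives; restricting them changes no value on \<open>I\<close>.\<close>

lemma up_class_eq_iff:
  assumes "f \<in> I \<rightarrow> X" "g \<in> I \<rightarrow> X"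
  shows "up_class I U X f = up_class I U X g \<longleftrightarrow> {i \<in> I. f i = g i} \<in> U"
proof -
  have "restrict f I \<in> I \<rightarrow>\<^sub>E X" "restrict g I \<in> I \<rightarrow>\<^sub>E X" using assms by auto
  moreover have "{i \<in> I. restrict f I i = restrict g I i} = {i \<in> I. f i = g i}" by auto
  ultimately show ?thesis
    unfolding up_class_def
    by (simp add: eq_equiv_class_iff[OF equiv_up_eq]) (simp add: up_eq_def)
qed

lemma up_class_cong: "(\<And>i. i \<in> I \<Longrightarrow> f i = g i) \<Longrightarrow> up_class I U X f = up_class I U X g"
  by (simp add: up_class_def restrict_def fun_eq_iff cong: if_cong)

lemma mem_up_class:
  assumes "f \<in> I \<rightarrow> X"
  shows "f' \<in> up_class I U X f \<longleftrightarrow> f' \<in> I \<rightarrow>\<^sub>E X \<and> {i \<in> I. f i = f' i} \<in> U"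
proof -
  have "{i \<in> I. restrict f I i = f' i} = {i \<in> I. f i = f' i}" by auto
  then show ?thesis using assms by (auto simp: up_class_def up_eq_def)
qed

lemma up_carrier_eq: "up_carrier I U X = up_class I U X ` (I \<rightarrow> X)"
proof
  show "up_carrier I U X \<subseteq> up_class I U X ` (I \<rightarrow> X)"
  proof
    fix c assume "c \<in> up_carrier I U X"
    then obtain f where f: "f \<in> I \<rightarrow>\<^sub>E X" "c = up_eq I U X `` {f}"
      unfolding up_carrier_def by (rule quotientE)
    then have "c = up_class I U X f"
      by (simp add: up_class_def PiE_restrict)
    then show "c \<in> up_class I U X ` (I \<rightarrow> X)"
      using f(1) by (simp add: PiE_iff Pi_iff)
  qed
  show "up_class I U X ` (I \<rightarrow> X) \<subseteq> up_carrier I U X"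
    unfolding up_carrier_def up_class_def by (intro image_subsetI quotientI) auto
qed

text \<open>All representatives yield the same class, and \<open>restrict f I\<close> is one of
  them, so the union in the definition of the operation is a single class.\<close>

lemma up_class_op1:
  assumes "\<And>a. a \<in> X \<Longrightarrow> h a \<in> X" and f: "f \<in> I \<rightarrow> X"
  shows "(\<Union>f'\<in>up_class I U X f. up_class I U X (\<lambda>i. h (f' i))) = up_class I U X (\<lambda>i. h (f i))"
proof -
  have "up_class I U X (\<lambda>i. h (f' i)) = up_class I U X (\<lambda>i. h (f i))"
    if "f' \<in> up_class I U X f" for f'
  proof (subst up_class_eq_iff)
    have *: "f' \<in> I \<rightarrow>\<^sub>E X" "{i \<in> I. f i = f' i} \<in> U"
      using that by (simp_all add: mem_up_class[OF f])
    show "(\<lambda>i. h (f' i)) \<in> I \<rightarrow> X" "(\<lambda>i. h (f i)) \<in> I \<rightarrow> X"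
      using * assms by (auto simp: PiE_iff Pi_iff)
    show "{i \<in> I. h (f' i) = h (f i)} \<in> U" using uf_Collect_mp2[OF *(2) *(2)] by simp
  qed
  moreover have "restrict f I \<in> up_class I U X f"
    using uf_whole f by (auto simp: mem_up_class cong: conj_cong)
  ultimately show ?thesis by blast
qed

lemma up_class_op2:
  assumes "\<And>a b. a \<in> X \<Longrightarrow> b \<in> X \<Longrightarrow> h a b \<in> X" and f: "f \<in> I \<rightarrow> X" and g: "g \<in> I \<rightarrow> X"
  shows "(\<Union>f'\<in>up_class I U X f. \<Union>g'\<in>up_class I U X g. up_class I U X (\<lambda>i. h (f' i) (g' i)))
    = up_class I U X (\<lambda>i. h (f i) (g i))"
proof -
  have "up_class I U X (\<lambda>i. h (f' i) (g' i)) = up_class I U X (\<lambda>i. h (f i) (g i))"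
    if "f' \<in> up_class I U X f" "g' \<in> up_class I U X g" for f' g'
  proof (subst up_class_eq_iff)
    have *: "f' \<in> I \<rightarrow>\<^sub>E X" "{i \<in> I. f i = f' i} \<in> U" "g' \<in> I \<rightarrow>\<^sub>E X" "{i \<in> I. g i = g' i} \<in> U"
      using that by (simp_all add: mem_up_class f g)
    show "(\<lambda>i. h (f' i) (g' i)) \<in> I \<rightarrow> X" "(\<lambda>i. h (f i) (g i)) \<in> I \<rightarrow> X"
      using * assms by (auto simp: PiE_iff Pi_iff)
    show "{i \<in> I. h (f' i) (g' i) = h (f i) (g i)} \<in> U" using uf_Collect_mp2[OF *(2) *(4)] by simp
  qed
  moreover have "restrict f I \<in> up_class I U X f" "restrict g I \<in> up_class I U X g"
    using uf_whole f g by (auto simp: mem_up_class cong: conj_cong)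
  ultimately show ?thesis by blast
qed

section \<open>Boolean structure and filters of the ultrapower of an algebra\<close>

context
  fixes M :: "('a, 'b) malg_scheme"
  assumes BA: "boolean_algebra_on M"
begin

lemma malg_ultrapower_simps:
  "carrier (malg_ultrapower I U M) = up_class I U (carrier M) ` (I \<rightarrow> carrier M)"
  "zero (malg_ultrapower I U M) = up_class I U (carrier M) (\<lambda>i. zero M)"
  "one (malg_ultrapower I U M) = up_class I U (carrier M) (\<lambda>i. one M)"
  "f \<in> I \<rightarrow> carrier M \<Longrightarrow> compl (malg_ultrapower I U M) (up_class I U (carrier M) f) =
     up_class I U (carrier M) (\<lambda>i. compl M (f i))"
  "f \<in> I \<rightarrow> carrier M \<Longrightarrow> g \<in> I \<rightarrow> carrier M \<Longrightarrow>
     meet (malg_ultrapower I U M) (up_class I U (carrier M) f) (up_class I U (carrier M) g) =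
     up_class I U (carrier M) (\<lambda>i. meet M (f i) (g i))"
  "f \<in> I \<rightarrow> carrier M \<Longrightarrow> g \<in> I \<rightarrow> carrier M \<Longrightarrow>
     join (malg_ultrapower I U M) (up_class I U (carrier M) f) (up_class I U (carrier M) g) =
     up_class I U (carrier M) (\<lambda>i. join M (f i) (g i))"
  using ba_closed[OF BA]
  by (simp_all add: malg_ultrapower_def Let_def up_carrier_eq up_class_op1 up_class_op2)

text \<open>The axioms are closure conditions and identities, so they hold index by index on
  representatives and pass to the classes.\<close>

lemma boolean_algebra_on_ultrapower: "boolean_algebra_on (malg_ultrapower I U M)"
proof -
  note [simp] = malg_ultrapower_simps(2-) ba_closed[OF BA] ba_one_zero[OF BA] Pi_iff
  have eqs: "join M (join M a b) c = join M a (join M b c)"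
      "join M a (meet M b c) = meet M (join M a b) (join M a c)"
    if "a \<in> carrier M" "b \<in> carrier M" "c \<in> carrier M" for a b c
    using BA that unfolding boolean_algebra_on_def by metis+
  note rules = ba_meet_commute[OF BA] ba_join_commute[OF BA] ba_meet_assoc[OF BA] ba_distrib[OF BA] eqs
  show ?thesis
    unfolding boolean_algebra_on_def malg_ultrapower_simps(1) ball_simps
    by (intro conjI ballI; simp; (intro imageI up_class_cong)?; (simp; fail | rule rules; simp; fail)?)
qed

text \<open>The ultraproduct of the filters \<open>F i\<close>, seen inside the ultrapower. The
  filter may vary with the index, which later allows a different assignment of truth values at each
  index.\<close>

definition filter_ultraproduct :: "('i \<Rightarrow> 'a set) \<Rightarrow> ('i \<Rightarrow> 'a) set set" where
  "filter_ultraproduct F = up_class I U (carrier M) ` {f \<in> I \<rightarrow> carrier M. {i \<in> I. f i \<in> F i} \<in> U}"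

lemma up_class_mem_filter_ultraproduct:
  assumes f: "f \<in> I \<rightarrow> carrier M"
  shows "up_class I U (carrier M) f \<in> filter_ultraproduct F \<longleftrightarrow> {i \<in> I. f i \<in> F i} \<in> U"
proof
  assume "up_class I U (carrier M) f \<in> filter_ultraproduct F"
  then obtain g where g: "g \<in> I \<rightarrow> carrier M" "{i \<in> I. g i \<in> F i} \<in> U"
    "up_class I U (carrier M) f = up_class I U (carrier M) g"
    by (auto simp: filter_ultraproduct_def)
  then have "{i \<in> I. f i = g i} \<in> U" using f by (simp add: up_class_eq_iff)
  then show "{i \<in> I. f i \<in> F i} \<in> U" by (rule uf_Collect_mp2[OF g(2)]) simp
qed (use f in \<open>auto simp: filter_ultraproduct_def\<close>)

text \<open>An instance of the theorem of Los: the conditions on a proper filter are first-order, so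
  they transfer from the \<open>F i\<close>.\<close>

lemma filter_ultraproduct_proper:
  assumes F: "\<And>i. i \<in> I \<Longrightarrow> F i \<in> proper_filters M"
  shows "filter_ultraproduct F \<in> proper_filters (malg_ultrapower I U M)"
proof -
  note [simp] = malg_ultrapower_simps ba_closed[OF BA] Pi_iff up_class_mem_filter_ultraproduct
  let ?c = "up_class I U (carrier M)"
  note D = proper_filtersD[OF F]
  have sub: "filter_ultraproduct F \<subseteq> carrier (malg_ultrapower I U M)"
    by (auto simp: filter_ultraproduct_def)
  have "meet (malg_ultrapower I U M) a b \<in> filter_ultraproduct F"
    if ab: "a \<in> filter_ultraproduct F" "b \<in> filter_ultraproduct F" for a b
  proof -
    obtain f g where "f \<in> I \<rightarrow> carrier M" "{i \<in> I. f i \<in> F i} \<in> U" "a = ?c f"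
       "g \<in> I \<rightarrow> carrier M" "{i \<in> I. g i \<in> F i} \<in> U" "b = ?c g"
      using ab by (auto simp: filter_ultraproduct_def)
    then show ?thesis
      using uf_Collect_mp2[OF \<open>{i \<in> I. f i \<in> F i} \<in> U\<close> \<open>{i \<in> I. g i \<in> F i} \<in> U\<close>] D(4) by simp
  qed
  moreover have "b \<in> filter_ultraproduct F"
    if ab: "a \<in> filter_ultraproduct F" "b \<in> carrier (malg_ultrapower I U M)"
      "meet (malg_ultrapower I U M) a b = a" for a b
  proof -
    obtain f g where fg: "f \<in> I \<rightarrow> carrier M" "{i \<in> I. f i \<in> F i} \<in> U" "a = ?c f"
       "g \<in> I \<rightarrow> carrier M" "b = ?c g"
      using ab by (auto simp: filter_ultraproduct_def)
    then have "{i \<in> I. meet M (f i) (g i) = f i} \<in> U"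
      using ab(3) by (simp add: up_class_eq_iff)
    from uf_Collect_mp2[OF fg(2) this, of "\<lambda>i. g i \<in> F i"]
    show ?thesis using D(5) fg by (auto simp: Pi_iff)
  qed
  moreover have "one (malg_ultrapower I U M) \<in> filter_ultraproduct F"
  proof -
    have "{i \<in> I. one M \<in> F i} = I" using D(2) by auto
    then show ?thesis using uf_whole by simp
  qed
  moreover have "zero (malg_ultrapower I U M) \<notin> filter_ultraproduct F"
  proof -
    have *: "{i \<in> I. zero M \<in> F i} = {}" using D(3) by auto
    have "{i \<in> I. zero M \<in> F i} \<notin> U" unfolding * by (rule uf_empty)
    then show ?thesis by simp
  qed
  ultimately show ?thesis
    using sub unfolding proper_filters_def by blast
qed

end

end

section \<open>Lindenbaum--Tarski algebras\<close>

lemma omega_fms_simps [simp]: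
  "Fls \<in> omega_fms" "Tru \<in> omega_fms"
  "Var x \<in> omega_fms \<longleftrightarrow> finite {..<x}"
  "Imp A B \<in> omega_fms \<longleftrightarrow> A \<in> omega_fms \<and> B \<in> omega_fms"
  "Neg A \<in> omega_fms \<longleftrightarrow> A \<in> omega_fms"
  "And A B \<in> omega_fms \<longleftrightarrow> A \<in> omega_fms \<and> B \<in> omega_fms"
  "Or A B \<in> omega_fms \<longleftrightarrow> A \<in> omega_fms \<and> B \<in> omega_fms"
  "Iff A B \<in> omega_fms \<longleftrightarrow> A \<in> omega_fms \<and> B \<in> omega_fms"
  by (auto simp: omega_fms_def Neg_def Tru_def And_def Or_def Iff_def)

lemma subst_simps [simp]:
  "subst s (Neg A) = Neg (subst s A)" "subst s Tru = Tru"
  "subst s (And A B) = And (subst s A) (subst s B)"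
  "subst s (Or A B) = Or (subst s A) (subst s B)"
  "subst s (Iff A B) = Iff (subst s A) (subst s B)"
  by (simp_all add: Neg_def Tru_def And_def Or_def Iff_def)

lemma truth_simps [simp]:
  "truth v (Neg A) \<longleftrightarrow> \<not> truth v A" "truth v Tru"
  "truth v (And A B) \<longleftrightarrow> truth v A \<and> truth v B"
  "truth v (Or A B) \<longleftrightarrow> truth v A \<or> truth v B"
  "truth v (Iff A B) \<longleftrightarrow> (truth v A \<longleftrightarrow> truth v B)"
  by (auto simp: Neg_def Tru_def And_def Or_def Iff_def)

lemma box_free_simps [simp]:
  "box_free (Neg A) \<longleftrightarrow> box_free A" "box_free Tru"
  "box_free (And A B) \<longleftrightarrow> box_free A \<and> box_free B"
  "box_free (Or A B) \<longleftrightarrow> box_free A \<and> box_free B"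
  "box_free (Iff A B) \<longleftrightarrow> box_free A \<and> box_free B"
  by (auto simp: Neg_def Tru_def And_def Or_def Iff_def)

section \<open>Propositional reasoning in a logic and the algebra of its omega-formulas\<close>

context
  fixes L :: "'v::{wellorder, infinite} fm set"
  assumes L: "logic L"
begin

lemma logic_mp: "Imp A B \<in> L \<Longrightarrow> A \<in> L \<Longrightarrow> B \<in> L"
  and logic_subst: "A \<in> L \<Longrightarrow> subst s A \<in> L"
  using L unfolding logic_def by blast+

text \<open>\<open>F\<close> is a propositional schema: its \<open>n\<close>-th metavariable \<open>p n\<close> is replaced by \<open>As ! n\<close>.\<close>

lemma logic_tautology_instance:
  assumes "\<And>p :: nat \<Rightarrow> 'v. tautology (F (\<lambda>n. Var (p n)))"
    and "\<And>(p :: nat \<Rightarrow> 'v) s. subst s (F (\<lambda>n. Var (p n))) = F (\<lambda>n. s (p n))"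
  shows "F (\<lambda>n. As ! n) \<in> L"
proof -
  \<comment> \<open>Distinct variables stand for the metavariables, so that \<open>inv p\<close>
    recovers the position in \<open>As\<close>.\<close>
  obtain p :: "nat \<Rightarrow> 'v" where p: "inj p"
    using infinite_countable_subset[OF infinite_UNIV] by auto
  have "subst (\<lambda>x. As ! inv p x) (F (\<lambda>n. Var (p n))) \<in> L"
    using L assms(1) unfolding logic_def by blast
  then show ?thesis using p by (simp add: assms(2))
qed

lemma logic_Iff_iff: "Iff A B \<in> L \<longleftrightarrow> Imp A B \<in> L \<and> Imp B A \<in> L"
proof -
  have 1: "Imp (Iff A B) (Imp A B) \<in> L" and 2: "Imp (Iff A B) (Imp B A) \<in> L"
    and 3: "Imp (Imp A B) (Imp (Imp B A) (Iff A B)) \<in> L"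
    using logic_tautology_instance[of "\<lambda>m. Imp (Iff (m 0) (m 1)) (Imp (m 0) (m 1))" "[A, B]"]
      logic_tautology_instance[of "\<lambda>m. Imp (Iff (m 0) (m 1)) (Imp (m 1) (m 0))" "[A, B]"]
      logic_tautology_instance[of
        "\<lambda>m. Imp (Imp (m 0) (m 1)) (Imp (Imp (m 1) (m 0)) (Iff (m 0) (m 1)))" "[A, B]"]
    by (auto simp: tautology_def)
  show ?thesis using 1 2 3 logic_mp by blast
qed

lemma logic_Iff_refl: "Iff A A \<in> L"
  using logic_tautology_instance[of "\<lambda>m. Iff (m 0) (m 0)" "[A]"] by (simp add: tautology_def)

lemma logic_Iff_sym: "Iff A B \<in> L \<longleftrightarrow> Iff B A \<in> L"
  by (auto simp: logic_Iff_iff)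

lemma logic_Iff_trans:
  assumes "Iff A B \<in> L" "Iff B C \<in> L"
  shows "Iff A C \<in> L"
proof -
  have "Imp (Iff A B) (Imp (Iff B C) (Iff A C)) \<in> L"
    using logic_tautology_instance[of
        "\<lambda>m. Imp (Iff (m 0) (m 1)) (Imp (Iff (m 1) (m 2)) (Iff (m 0) (m 2)))" "[A, B, C]"]
    by (auto simp: tautology_def)
  then show ?thesis using assms logic_mp by blast
qed

lemma logic_Iff_Neg:
  assumes "Iff A A' \<in> L"
  shows "Iff (Neg A) (Neg A') \<in> L"
proof -
  have "Imp (Iff A A') (Iff (Neg A) (Neg A')) \<in> L"
    using logic_tautology_instance[of
        "\<lambda>m. Imp (Iff (m 0) (m 1)) (Iff (Neg (m 0)) (Neg (m 1)))" "[A, A']"]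
    by (auto simp: tautology_def)
  then show ?thesis using assms logic_mp by blast
qed

lemma logic_Iff_And:
  assumes "Iff A A' \<in> L" "Iff B B' \<in> L"
  shows "Iff (And A B) (And A' B') \<in> L"
proof -
  have "Imp (Iff A A') (Imp (Iff B B') (Iff (And A B) (And A' B'))) \<in> L"
    using logic_tautology_instance[of "\<lambda>m. Imp (Iff (m 0) (m 1))
        (Imp (Iff (m 2) (m 3)) (Iff (And (m 0) (m 2)) (And (m 1) (m 3))))" "[A, A', B, B']"]
    by (auto simp: tautology_def)
  then show ?thesis using assms logic_mp by blast
qed

lemma logic_Iff_Or:
  assumes "Iff A A' \<in> L" "Iff B B' \<in> L"
  shows "Iff (Or A B) (Or A' B') \<in> L"
proof -
  have "Imp (Iff A A') (Imp (Iff B B') (Iff (Or A B) (Or A' B'))) \<in> L"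
    using logic_tautology_instance[of "\<lambda>m. Imp (Iff (m 0) (m 1))
        (Imp (Iff (m 2) (m 3)) (Iff (Or (m 0) (m 2)) (Or (m 1) (m 3))))" "[A, A', B, B']"]
    by (auto simp: tautology_def)
  then show ?thesis using assms logic_mp by blast
qed

lemma logic_And_iff: "And A B \<in> L \<longleftrightarrow> A \<in> L \<and> B \<in> L"
proof -
  have "Imp (And A B) A \<in> L" "Imp (And A B) B \<in> L" "Imp A (Imp B (And A B)) \<in> L"
    using logic_tautology_instance[of "\<lambda>m. Imp (And (m 0) (m 1)) (m 0)" "[A, B]"]
      logic_tautology_instance[of "\<lambda>m. Imp (And (m 0) (m 1)) (m 1)" "[A, B]"]
      logic_tautology_instance[of "\<lambda>m. Imp (m 0) (Imp (m 1) (And (m 0) (m 1)))" "[A, B]"]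
    by (auto simp: tautology_def)
  then show ?thesis using logic_mp by blast
qed

lemma logic_Tru: "Tru \<in> L"
  using logic_tautology_instance[of "\<lambda>m. Tru" "[]"] by (simp add: tautology_def)

abbreviation lt :: "'v fm \<Rightarrow> 'v fm set" where
  "lt \<equiv> lt_class (omega_part L)"

lemma mem_lt: "A \<in> omega_fms \<Longrightarrow> B \<in> lt A \<longleftrightarrow> B \<in> omega_fms \<and> Iff A B \<in> L"
  by (auto simp: lt_class_def omega_part_def)

lemma lt_eq_iff:
  assumes "A \<in> omega_fms" "B \<in> omega_fms"
  shows "lt A = lt B \<longleftrightarrow> Iff A B \<in> L"
proof
  assume "lt A = lt B"
  moreover have "B \<in> lt B" using assms by (simp add: mem_lt logic_Iff_refl)
  ultimately have "B \<in> lt A" by blast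
  then show "Iff A B \<in> L" using assms by (simp add: mem_lt)
next
  assume "Iff A B \<in> L"
  then show "lt A = lt B"
    using assms logic_Iff_trans logic_Iff_sym by (auto simp: mem_lt set_eq_iff)
qed

text \<open>Provable equivalence is a congruence for the connectives, so each union over
  representatives collapses to one class.\<close>

lemma lindenbaum_simps:
  "carrier (lindenbaum (omega_part L)) = lt ` omega_fms"
  "zero (lindenbaum (omega_part L)) = lt Fls"
  "one (lindenbaum (omega_part L)) = lt Tru"
  "A \<in> omega_fms \<Longrightarrow> compl (lindenbaum (omega_part L)) (lt A) = lt (Neg A)"
  "A \<in> omega_fms \<Longrightarrow> B \<in> omega_fms \<Longrightarrow>
     meet (lindenbaum (omega_part L)) (lt A) (lt B) = lt (And A B)"
  "A \<in> omega_fms \<Longrightarrow> B \<in> omega_fms \<Longrightarrow>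
     join (lindenbaum (omega_part L)) (lt A) (lt B) = lt (Or A B)"
proof -
  assume A: "A \<in> omega_fms"
  then have A_mem: "A \<in> lt A" by (simp add: mem_lt logic_Iff_refl)
  have "lt (Neg A') = lt (Neg A)" if "A' \<in> lt A" for A'
    using that A by (simp add: mem_lt lt_eq_iff logic_Iff_Neg logic_Iff_sym[of "Neg A'"])
  then have "(\<Union>A'\<in>lt A. lt (Neg A')) = lt (Neg A)"
    using A_mem by (intro SUP_eq_const) blast+
  then show "compl (lindenbaum (omega_part L)) (lt A) = lt (Neg A)"
    by (simp add: lindenbaum_def)
  assume B: "B \<in> omega_fms"
  then have B_mem: "B \<in> lt B" by (simp add: mem_lt logic_Iff_refl)
  have "lt (And A' B') = lt (And A B)" "lt (Or A' B') = lt (Or A B)"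
    if "A' \<in> lt A" "B' \<in> lt B" for A' B'
    using that A B by (simp_all add: mem_lt lt_eq_iff logic_Iff_And logic_Iff_Or
        logic_Iff_sym[of "And A' B'"] logic_Iff_sym[of "Or A' B'"])
  then have "(\<Union>A'\<in>lt A. \<Union>B'\<in>lt B. lt (And A' B')) = lt (And A B)"
    "(\<Union>A'\<in>lt A. \<Union>B'\<in>lt B. lt (Or A' B')) = lt (Or A B)"
    using A_mem B_mem by (intro SUP_eq_const; blast)+
  then show "meet (lindenbaum (omega_part L)) (lt A) (lt B) = lt (And A B)"
    "join (lindenbaum (omega_part L)) (lt A) (lt B) = lt (Or A B)"
    by (simp_all add: lindenbaum_def)
qed (auto simp: lindenbaum_def)

lemma boolean_algebra_on_lindenbaum: "boolean_algebra_on (lindenbaum (omega_part L))"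
proof -
  note taut = logic_tautology_instance
  have eq1: "Iff (And A Tru) A \<in> L" for A
    using taut[of "\<lambda>m. Iff (And (m 0) Tru) (m 0)" "[A]"]
    by (auto simp: tautology_def)
  have eq2: "Iff (Or A Fls) A \<in> L" for A
    using taut[of "\<lambda>m. Iff (Or (m 0) Fls) (m 0)" "[A]"]
    by (auto simp: tautology_def)
  have eq3: "Iff (And A (Neg A)) Fls \<in> L" for A
    using taut[of "\<lambda>m. Iff (And (m 0) (Neg (m 0))) Fls" "[A]"]
    by (auto simp: tautology_def)
  have eq4: "Iff (Or A (Neg A)) Tru \<in> L" for A
    using taut[of "\<lambda>m. Iff (Or (m 0) (Neg (m 0))) Tru" "[A]"]
    by (auto simp: tautology_def)
  have eq5: "Iff (And A B) (And B A) \<in> L" for A B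
    using taut[of "\<lambda>m. Iff (And (m 0) (m 1)) (And (m 1) (m 0))" "[A, B]"]
    by (auto simp: tautology_def)
  have eq6: "Iff (Or A B) (Or B A) \<in> L" for A B
    using taut[of "\<lambda>m. Iff (Or (m 0) (m 1)) (Or (m 1) (m 0))" "[A, B]"]
    by (auto simp: tautology_def)
  have eq7: "Iff (And (And A B) C) (And A (And B C)) \<in> L" for A B C
    using taut[of "\<lambda>m. Iff (And (And (m 0) (m 1)) (m 2)) (And (m 0) (And (m 1) (m 2)))" "[A, B, C]"]
    by (auto simp: tautology_def)
  have eq8: "Iff (Or (Or A B) C) (Or A (Or B C)) \<in> L" for A B C
    using taut[of "\<lambda>m. Iff (Or (Or (m 0) (m 1)) (m 2)) (Or (m 0) (Or (m 1) (m 2)))" "[A, B, C]"]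
    by (auto simp: tautology_def)
  have eq9: "Iff (And A (Or B C)) (Or (And A B) (And A C)) \<in> L" for A B C
    using taut[of "\<lambda>m. Iff (And (m 0) (Or (m 1) (m 2))) (Or (And (m 0) (m 1)) (And (m 0) (m 2)))" "[A, B, C]"]
    by (auto simp: tautology_def)
  have eq10: "Iff (Or A (And B C)) (And (Or A B) (Or A C)) \<in> L" for A B C
    using taut[of "\<lambda>m. Iff (Or (m 0) (And (m 1) (m 2))) (And (Or (m 0) (m 1)) (Or (m 0) (m 2)))" "[A, B, C]"]
    by (auto simp: tautology_def)
  show ?thesis
    unfolding boolean_algebra_on_def lindenbaum_simps(1) ball_simps
    by (simp add: lindenbaum_simps(2-) lt_eq_iff eq1 eq2 eq3 eq4 eq5 eq6 eq7 eq8 eq9 eq10)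
qed

text \<open>The classes of formulas that \<open>s\<close> turns into theorems. This need not be an
  ultrafilter: even for truth constants, formulas such as \<open>Box Fls\<close> may be decided
  neither way.\<close>

definition subst_filter :: "('v \<Rightarrow> 'v fm) \<Rightarrow> 'v fm set set" where
  "subst_filter s = lt ` {A \<in> omega_fms. subst s A \<in> L}"

text \<open>Closure of \<open>L\<close> under substitution makes membership independent of the
  representative.\<close>

lemma lt_mem_subst_filter:
  assumes A: "A \<in> omega_fms"
  shows "lt A \<in> subst_filter s \<longleftrightarrow> subst s A \<in> L"
proof
  assume "lt A \<in> subst_filter s"
  then obtain B where B: "B \<in> omega_fms" "subst s B \<in> L" "lt A = lt B"
    by (auto simp: subst_filter_def)
  then have "Iff A B \<in> L" using A by (simp add: lt_eq_iff)
  from logic_subst[OF this, of s] show "subst s A \<in> L"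
    using B(2) logic_mp by (auto simp: logic_Iff_iff)
qed (use A in \<open>auto simp: subst_filter_def\<close>)

lemma subst_filter_proper:
  assumes "Fls \<notin> L"
  shows "subst_filter s \<in> proper_filters (lindenbaum (omega_part L))"
  unfolding proper_filters_def lindenbaum_simps(1)
proof (intro CollectI conjI ballI impI)
  show "subst_filter s \<subseteq> lt ` omega_fms" by (auto simp: subst_filter_def)
  show "one (lindenbaum (omega_part L)) \<in> subst_filter s"
    "zero (lindenbaum (omega_part L)) \<notin> subst_filter s"
    using assms logic_Tru by (simp_all add: lindenbaum_simps lt_mem_subst_filter)
next
  fix a b assume "a \<in> subst_filter s" "b \<in> subst_filter s"
  then obtain A B where "A \<in> omega_fms" "subst s A \<in> L" "a = lt A"
    "B \<in> omega_fms" "subst s B \<in> L" "b = lt B"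
    by (auto simp: subst_filter_def)
  then show "meet (lindenbaum (omega_part L)) a b \<in> subst_filter s"
    by (simp add: lindenbaum_simps lt_mem_subst_filter logic_And_iff)
next
  fix a b assume "a \<in> subst_filter s" and b: "b \<in> lt ` omega_fms"
    and ab: "meet (lindenbaum (omega_part L)) a b = a"
  then obtain A B where "A \<in> omega_fms" "subst s A \<in> L" "a = lt A" "B \<in> omega_fms" "b = lt B"
    by (auto simp: subst_filter_def)
  moreover from this ab have "lt (And A B) = lt A"
    by (simp add: lindenbaum_simps)
  moreover have "lt A \<in> subst_filter s"
    using \<open>a = lt A\<close> \<open>a \<in> subst_filter s\<close> by simp
  ultimately have "lt (And A B) \<in> subst_filter s" by simp
  then have "subst s (And A B) \<in> L"
    using \<open>A \<in> omega_fms\<close> \<open>B \<in> omega_fms\<close> lt_mem_subst_filter[of "And A B" s] by simp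
  then show "b \<in> subst_filter s"
    using \<open>B \<in> omega_fms\<close> \<open>b = lt B\<close> by (simp add: lt_mem_subst_filter logic_And_iff)
qed

text \<open>This is the independence of the variables: since \<open>V\<close> is arbitrary, every
  pattern of truth values is realised. Consistency keeps \<open>Fls\<close> and
  \<open>Neg Tru\<close> out of \<open>L\<close>.\<close>

lemma subst_filter_constants:
  fixes V :: "'v set"
  assumes "Fls \<notin> L" "finite {..<x}"
  defines "s \<equiv> \<lambda>z. if z \<in> V then Tru else Fls"
  shows "lt (Var x) \<in> subst_filter s \<longleftrightarrow> x \<in> V"
    and "compl (lindenbaum (omega_part L)) (lt (Var x)) \<in> subst_filter s \<longleftrightarrow> x \<notin> V"
proof -
  have "Neg Fls \<in> L" "Neg Tru \<notin> L"
    using assms(1) logic_Tru logic_mp[of Tru Fls] by (auto simp: Tru_def Neg_def)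
  then show "lt (Var x) \<in> subst_filter s \<longleftrightarrow> x \<in> V"
    "compl (lindenbaum (omega_part L)) (lt (Var x)) \<in> subst_filter s \<longleftrightarrow> x \<notin> V"
    using assms(1,2) logic_Tru by (auto simp: lindenbaum_simps lt_mem_subst_filter s_def)
qed

end

section \<open>Cardinalities\<close>

instance fm :: (countable) countable
  by countable_datatype

text \<open>The type of variables may be uncountable, so formulas over \<open>V\<close> are renamed
  injectively to formulas over the naturals.\<close>

lemma countable_fms_vars:
  assumes "countable V"
  shows "countable {A. vars A \<subseteq> V}"
proof (rule countable_image_inj_on)
  show "countable (map_fm (to_nat_on V) ` {A. vars A \<subseteq> V})" by (rule countableI_type)
  show "inj_on (map_fm (to_nat_on V)) {A. vars A \<subseteq> V}"
  proof (rule inj_onI)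
    fix A B assume AB: "A \<in> {A. vars A \<subseteq> V}" "B \<in> {A. vars A \<subseteq> V}"
      "map_fm (to_nat_on V) A = map_fm (to_nat_on V) B"
    have "x = y" if "x \<in> vars A" "y \<in> vars B" "to_nat_on V x = to_nat_on V y" for x y
      using that AB(1,2) assms by (auto dest: inj_onD[OF inj_on_to_nat_on])
    then show "A = B"
      using AB(3) fm.inj_map_strong by blast
  qed
qed

lemma countable_finite_initial_segments: "countable {x :: 'v::wellorder. finite {..<x}}"
proof (rule countableI)
  show "inj_on (\<lambda>x. card {..<x}) {x :: 'v. finite {..<x}}"
  proof (rule linorder_inj_onI)
    fix x y :: 'v assume "x < y" "y \<in> {x. finite {..<x}}"
    then have "card {..<x} < card {..<y}" by (intro psubset_card_mono) auto
    then show "card {..<x} \<noteq> card {..<y}" by simp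
  qed auto
qed

text \<open>Otherwise some element lies outside the set, and the least such element has all its
  predecessors inside, hence finitely many.\<close>

lemma infinite_finite_initial_segments: "infinite {x :: 'v::{wellorder, infinite}. finite {..<x}}"
proof
  let ?V = "{x :: 'v. finite {..<x}}"
  assume fin: "finite ?V"
  then obtain y where y: "y \<notin> ?V" using arb_element by blast
  define m where "m = (LEAST x. x \<notin> ?V)"
  have "m \<notin> ?V" unfolding m_def using y by (rule LeastI)
  moreover have "{..<m} \<subseteq> ?V"
    using not_less_Least[of _ "\<lambda>x. x \<notin> ?V"] unfolding m_def by blast
  ultimately show False using fin finite_subset by blast
qed

lemma countable_omega_fms: "countable omega_fms"
  using countable_fms_vars[OF countable_finite_initial_segments]
  by (simp add: omega_fms_def subset_iff Ball_def)

section \<open>Size bounds for power sets and ultrapowers\<close>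

lemma Pow_lepoll_mono:
  assumes "A \<lesssim> B"
  shows "Pow A \<lesssim> Pow B"
proof -
  obtain f where f: "inj_on f A" "f ` A \<subseteq> B" using assms by (auto simp: lepoll_def)
  have "inj_on (image f) (Pow A)" using f(1) by (rule inj_on_image_Pow)
  moreover have "image f ` Pow A \<subseteq> Pow B" using f(2) by auto
  ultimately show ?thesis unfolding lepoll_def by blast
qed

lemma countable_lepoll_nat: "countable A \<Longrightarrow> A \<lesssim> (UNIV :: nat set)"
  by (auto simp: lepoll_def countable_def)

lemma ultrafilters_lepoll_Pow: "ultrafilters M \<lesssim> Pow (carrier M)"
  by (rule subset_imp_lepoll) (auto simp: ultrafilters_def)

text \<open>A sequence of sets of naturals over a countable index set is coded by a single set of
  pairs, and the ultrapower is a quotient of the set of sequences.\<close>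

lemma up_carrier_lepoll:
  fixes X :: "'a set" and I :: "'i set"
  assumes I: "countable I" and X: "X \<lesssim> (UNIV :: nat set set)"
  shows "up_carrier I U X \<lesssim> (UNIV :: nat set set)"
proof -
  obtain h :: "'a \<Rightarrow> nat set" where h: "inj_on h X" using X by (auto simp: lepoll_def)
  define code where
    "code f = {prod_encode (to_nat_on I i, n) | i n. i \<in> I \<and> n \<in> h (f i)}" for f
  have mem: "prod_encode (to_nat_on I i, n) \<in> code f \<longleftrightarrow> n \<in> h (f i)" if "i \<in> I" for i n f
    using that inj_on_to_nat_on[OF I] by (auto simp: code_def dest: inj_onD)
  have "inj_on code (I \<rightarrow>\<^sub>E X)"
  proof (rule inj_onI)
    fix f g assume fg: "f \<in> I \<rightarrow>\<^sub>E X" "g \<in> I \<rightarrow>\<^sub>E X" "code f = code g"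
    show "f = g"
    proof (rule PiE_ext[OF fg(1,2)])
      fix i assume i: "i \<in> I"
      have "h (f i) = h (g i)" using mem[OF i, of _ f] mem[OF i, of _ g] fg(3) by blast
      then show "f i = g i" using h fg(1,2) i by (auto dest: inj_onD)
    qed
  qed
  then have "(I \<rightarrow>\<^sub>E X) \<lesssim> (UNIV :: nat set set)" unfolding lepoll_def by blast
  moreover have "up_carrier I U X = (\<lambda>f. up_eq I U X `` {f}) ` (I \<rightarrow>\<^sub>E X)"
    by (auto simp: up_carrier_def quotient_def)
  ultimately show ?thesis by (metis image_lepoll lepoll_trans)
qed

text \<open>The diagonal embedding: distinct constant functions agree on the empty set of indices,
  which is not in \<open>U\<close>.\<close>

lemma lepoll_up_carrier:
  assumes UF: "ultrafilter_on I U"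
  shows "X \<lesssim> up_carrier I U X"
proof -
  have "inj_on (\<lambda>x. up_class I U X (\<lambda>i. x)) X"
  proof (rule inj_onI)
    fix x y assume "x \<in> X" "y \<in> X" "up_class I U X (\<lambda>i. x) = up_class I U X (\<lambda>i. y)"
    then have "{i \<in> I. x = y} \<in> U" using up_class_eq_iff[OF UF, of "\<lambda>i. x" X "\<lambda>i. y"] by simp
    then show "x = y" using uf_empty[OF UF] by (cases "x = y") simp_all
  qed
  moreover have "(\<lambda>x. up_class I U X (\<lambda>i. x)) ` X \<subseteq> up_carrier I U X"
    unfolding up_carrier_eq[OF UF] by (intro image_subsetI imageI) simp
  ultimately show ?thesis unfolding lepoll_def by blast
qed

section \<open>Counting the ultrafilters of the algebra and of its ultrapower\<close>

context
  fixes L :: "'v::{wellorder, infinite} fm set" and q :: "nat \<Rightarrow> 'v"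
  assumes L: "logic L" and con: "Fls \<notin> L"
    and q: "inj q" "range q \<subseteq> {x. finite {..<x}}"
begin

abbreviation "LT \<equiv> lindenbaum (omega_part L)"

lemma finite_below_q: "finite {..<q n}"
  using q(2) by blast

lemma lt_Var_q_closed: "lt_class (omega_part L) (Var (q n)) \<in> carrier LT"
  by (simp add: lindenbaum_simps(1)[OF L] finite_below_q)

text \<open>The upper bound holds because the algebra is countable, the lower bound because the
  variables \<open>q n\<close> are independent.\<close>

lemma ultrafilters_lindenbaum_eqpoll: "ultrafilters LT \<approx> (UNIV :: nat set set)"
proof (rule lepoll_antisym)
  have "carrier LT \<lesssim> (UNIV :: nat set)"
    unfolding lindenbaum_simps(1)[OF L]
    by (intro countable_lepoll_nat countable_image countable_omega_fms)
  then show "ultrafilters LT \<lesssim> (UNIV :: nat set set)"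
    using lepoll_trans[OF ultrafilters_lepoll_Pow Pow_lepoll_mono] by (metis Pow_UNIV)
  have "Pow (UNIV :: nat set) \<lesssim> ultrafilters LT"
  proof (rule Pow_lepoll_ultrafilters[OF boolean_algebra_on_lindenbaum[OF L]])
    fix n show "lt_class (omega_part L) (Var (q n)) \<in> carrier LT" by (rule lt_Var_q_closed)
  next
    fix D Y :: "nat set"
    let ?F = "subst_filter L (\<lambda>z. if z \<in> q ` Y then Tru else Fls)"
    have "q n \<in> q ` Y \<longleftrightarrow> n \<in> Y" for n using q(1) by (auto dest: injD)
    then have "\<forall>n\<in>D. if n \<in> Y then lt_class (omega_part L) (Var (q n)) \<in> ?F
        else compl LT (lt_class (omega_part L) (Var (q n))) \<in> ?F"
      using subst_filter_constants[OF L con finite_below_q, where V = "q ` Y"] by simp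
    then show "\<exists>F\<in>proper_filters LT. \<forall>n\<in>D. if n \<in> Y then lt_class (omega_part L) (Var (q n)) \<in> F
        else compl LT (lt_class (omega_part L) (Var (q n))) \<in> F"
      using subst_filter_proper[OF L con] by blast
  qed
  then show "(UNIV :: nat set set) \<lesssim> ultrafilters LT" by simp
qed

context
  fixes I :: "'i set" and U :: "'i set set"
  assumes I: "countable I" and UF: "ultrafilter_on I U" and np: "\<not> principal_on I U"
begin

text \<open>
  For different \<open>S\<close> these functions of \<open>i\<close> agree at finitely many \<open>i\<close> only, so any finitely many
  of them take pairwise different values almost everywhere.
\<close>

definition branch :: "nat set \<Rightarrow> 'i \<Rightarrow> 'v" where
  "branch S i = q (set_encode (S \<inter> {..<to_nat_on I i}))"

lemma branch_eq_iff: "branch S i = branch T i \<longleftrightarrow> S \<inter> {..<to_nat_on I i} = T \<inter> {..<to_nat_on I i}"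
  using q(1) by (simp add: branch_def inj_eq set_encode_eq)

text \<open>If \<open>n\<close> lies in exactly one of the two sets, their parts differ at every
  index coded above \<open>n\<close>, and only finitely many indices have code at most
  \<open>n\<close>.\<close>

lemma finite_branch_eq:
  assumes "S \<noteq> T"
  shows "finite {i \<in> I. branch S i = branch T i}"
proof -
  obtain n where n: "(n \<in> S) \<noteq> (n \<in> T)" using assms by blast
  have "to_nat_on I i \<le> n" if "branch S i = branch T i" for i
    using that n unfolding branch_eq_iff by (metis Int_iff lessThan_iff not_le)
  then have "{i \<in> I. branch S i = branch T i} \<subseteq> to_nat_on I -` {..n} \<inter> I" by auto
  then show ?thesis
    by (rule finite_subset) (intro finite_vimage_IntI finite_atMost inj_on_to_nat_on I)
qed

text \<open>The exceptional indices form a finite union, over pairs from \<open>D\<close>, of finite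
  sets, and a nonprincipal ultrafilter contains no finite set.\<close>

lemma branch_inj_almost_everywhere:
  assumes "finite D"
  shows "{i \<in> I. inj_on (\<lambda>S. branch S i) D} \<in> U"
proof -
  have "I - {i \<in> I. inj_on (\<lambda>S. branch S i) D}
      \<subseteq> (\<Union>(S, T)\<in>{p \<in> D \<times> D. fst p \<noteq> snd p}. {i \<in> I. branch S i = branch T i})"
    by (fastforce simp: inj_on_def)
  moreover have "finite \<dots>"
    using assms finite_branch_eq by auto
  ultimately have "finite (I - {i \<in> I. inj_on (\<lambda>S. branch S i) D})"
    by (rule finite_subset)
  then have "I - {i \<in> I. inj_on (\<lambda>S. branch S i) D} \<notin> U"
    using finite_notin_nonprincipal_uf[OF UF np] by blast
  then show ?thesis
    using uf_compl[OF UF, of "{i \<in> I. inj_on (\<lambda>S. branch S i) D}"] by blast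
qed

lemma ultrafilters_ultrapower_eqpoll:
  "ultrafilters (malg_ultrapower I U LT) \<approx> Pow (UNIV :: nat set set)"
proof (rule lepoll_antisym)
  let ?M = "malg_ultrapower I U LT"
  note BA = boolean_algebra_on_lindenbaum[OF L]
  have "carrier LT \<lesssim> (UNIV :: nat set)"
    unfolding lindenbaum_simps(1)[OF L]
    by (intro countable_lepoll_nat countable_image countable_omega_fms)
  \<comment> \<open>The countable bound is weakened to the continuum, the form that the coding of
    sequences expects.\<close>
  also have "(UNIV :: nat set) \<lesssim> (UNIV :: nat set set)"
    using lepoll_Pow_self[of "UNIV :: nat set"] by simp
  finally have "carrier ?M \<lesssim> (UNIV :: nat set set)"
    using up_carrier_lepoll[OF I] by (simp add: malg_ultrapower_def Let_def)
  then show "ultrafilters ?M \<lesssim> Pow (UNIV :: nat set set)"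
    by (meson lepoll_trans ultrafilters_lepoll_Pow Pow_lepoll_mono)
  define g where "g S i = lt_class (omega_part L) (Var (branch S i))" for S i
  let ?g = "\<lambda>S. up_class I U (carrier LT) (g S)"
  have g: "g S \<in> I \<rightarrow> carrier LT" for S
    by (simp add: g_def branch_def lt_Var_q_closed)
  show "Pow (UNIV :: nat set set) \<lesssim> ultrafilters ?M"
  proof (rule Pow_lepoll_ultrafilters[OF boolean_algebra_on_ultrapower[OF UF BA]])
    show "?g S \<in> carrier ?M" for S
      unfolding malg_ultrapower_simps(1)[OF UF BA] using g by blast
  next
    fix D Y :: "nat set set" assume D: "finite D" "Y \<subseteq> D"
    \<comment> \<open>The variables to be made true at index \<open>i\<close>: the values there of
      the branches selected by \<open>Y\<close>.\<close>
    define V where "V i = (\<lambda>S. branch S i) ` Y" for i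
    define F where "F i = subst_filter L (\<lambda>z. if z \<in> V i then Tru else Fls)" for i
    have F: "g S i \<in> F i \<longleftrightarrow> branch S i \<in> V i"
      "compl LT (g S i) \<in> F i \<longleftrightarrow> branch S i \<notin> V i" for S i
      unfolding F_def g_def branch_def
      by (rule subst_filter_constants[OF L con finite_below_q])+
    \<comment> \<open>A branch outside \<open>Y\<close> might share its value at \<open>i\<close>
      with one in \<open>Y\<close>; this cannot happen where the branches in \<open>D\<close> are
      pairwise distinct.\<close>
    have ae: "{i \<in> I. branch S i \<in> V i \<longleftrightarrow> S \<in> Y} \<in> U" if "S \<in> D" for S
      by (rule uf_mono[OF UF branch_inj_almost_everywhere[OF D(1)]])
        (use that D(2) in \<open>auto simp: V_def dest: inj_onD\<close>)
    have "if S \<in> Y then ?g S \<in> filter_ultraproduct I U LT F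
        else compl ?M (?g S) \<in> filter_ultraproduct I U LT F" if "S \<in> D" for S
      using ae[OF that] g[of S]
      by (cases "S \<in> Y") (simp_all add: malg_ultrapower_simps(4)[OF UF BA] F Pi_iff ba_closed(3)[OF BA]
          up_class_mem_filter_ultraproduct[OF UF BA])
    moreover have "filter_ultraproduct I U LT F \<in> proper_filters ?M"
      unfolding F_def by (intro filter_ultraproduct_proper[OF UF BA] subst_filter_proper[OF L con])
    ultimately show "\<exists>F\<in>proper_filters ?M. \<forall>S\<in>D. if S \<in> Y then ?g S \<in> F else compl ?M (?g S) \<in> F"
      by blast
  qed
qed

end
end

text \<open>Consistency is assumed because the algebra of the inconsistent logic has one element and
  hence no ultrafilters. The sizes are expressed by equipollence with the reals and with their power
  set.\<close>

theorem theorem4p4: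
  fixes L :: "'v::{wellorder, infinite} fm set"
    and I :: "'i set"
    and U :: "'i set set"
  assumes "logic L" and "Fls \<notin> L"
    and "countable I" and "ultrafilter_on I U" and "\<not> principal_on I U"
  shows "worlds (frame_ultrapower I U (canonical_frame (lindenbaum (omega_part L))))
           \<approx> (UNIV :: real set) \<and>
         worlds (canonical_frame (malg_ultrapower I U (lindenbaum (omega_part L))))
           \<approx> Pow (UNIV :: real set)"
proof
  let ?X = "ultrafilters (lindenbaum (omega_part L))"
  obtain q :: "nat \<Rightarrow> 'v" where q: "inj q" "range q \<subseteq> {x. finite {..<x}}"
    using infinite_countable_subset[OF infinite_finite_initial_segments] by blast
  have X: "?X \<approx> (UNIV :: nat set set)"
    by (rule ultrafilters_lindenbaum_eqpoll[OF assms(1,2) q])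
  \<comment> \<open>The ultrapower lies between \<open>?X\<close>, embedded diagonally, and the
    continuum, by the coding of sequences.\<close>
  then have "up_carrier I U ?X \<approx> (UNIV :: nat set set)"
    using up_carrier_lepoll[OF assms(3)] lepoll_up_carrier[OF assms(4)]
    by (meson eqpoll_imp_lepoll eqpoll_sym lepoll_antisym lepoll_trans)
  then show "worlds (frame_ultrapower I U (canonical_frame (lindenbaum (omega_part L))))
      \<approx> (UNIV :: real set)"
    using eqpoll_trans[OF _ nat_sets_eqpoll_reals] by (simp add: frame_ultrapower_def canonical_frame_def)
  have "Pow (UNIV :: nat set set) \<approx> Pow (UNIV :: real set)"
    using nat_sets_eqpoll_reals
    by (intro lepoll_antisym Pow_lepoll_mono) (auto intro: eqpoll_imp_lepoll eqpoll_sym)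
  then show "worlds (canonical_frame (malg_ultrapower I U (lindenbaum (omega_part L))))
      \<approx> Pow (UNIV :: real set)"
    using eqpoll_trans[OF ultrafilters_ultrapower_eqpoll[OF assms(1,2) q assms(3-5)]]
    by (simp add: canonical_frame_def)
qed

end
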